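(* Let $d\ge 2$, $e\ge 1$, $n\ge 1$ be integers, and suppose that $[n]$ is the disjoint union of sets $X_1,\ldots,X_e$. Let $\mathcal{D}=\{(A_i^{(1)},\dots, A_i^{(d)})\}_{1\le i\le m}$ be a skew Bollobás system of $d$-partitions of $[n]$. Let $S=\bigcup_{i=1}^m\bigcup_{r=1}^d A_i^{(r)}$ and $s_k=|S\cap X_k|$ for $k\in[e]$. Then $$\sum_{i=1}^{m}\left(\prod_{k=1}^{e}\binom{\sum_{r=1}^{d}|A_i^{(r)}\cap X_k|}{|A_i^{(1)}\cap X_k|,\ldots,|A_{i}^{(d)}\cap X_{k}|}\right)^{-1}\le \prod_{k=1}^{e}\binom{s_k+d-1}{d-1}.$$ Moreover, the upper bound is tight: for every $n\ge 1$, $d\ge 2$ and every decomposition of $[n]$ as a disjoint union of sets $X_1,\ldots,X_e$, there exists a skew Bollobás system of $d$-partitions of $[n]$ with $s_k=|X_k|$ for all $k\in[e]$ for which equality holds.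
   Context: For a positive integer $n$, $[n]=\{1,\dots,n\}$. For $d\ge 2$, a $d$-partition of $[n]$ is a tuple $(A^{(1)},\dots,A^{(d)})$ of (possibly empty) pairwise disjoint subsets of $[n]$; their union need not be all of $[n]$. A family $\{(A_i^{(1)},\dots,A_i^{(d)})\}_{1\le i\le m}$ of $d$-partitions of $[n]$ is a skew Bollobás system if for any $1\le i<j\le m$ there exist $1\le p<q\le d$ such that $A_i^{(p)}\cap A_j^{(q)}\neq\emptyset$. For non-negative integers $a_1,\ldots,a_d$ with $a_1+\cdots+a_d\le N$, $\binom{N}{a_1,\ldots,a_d}=\frac{N!}{a_1!\cdots a_d!(N-a_1-\cdots-a_d)!}$. *)

theory Defs
  imports Complex_Main "HOL-Library.Disjoint_Sets"
begin

text \<open>A \<open>d\<close>-tuple of sets is a function \<open>P :: nat \<Rightarrow> nat set\<close> of which only the values at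
  \<open>1, \<dots>, d\<close> matter; likewise a family of \<open>m\<close> such tuples is a function \<open>A\<close> of which only the
  values \<open>A i r\<close> with \<open>1 \<le> i \<le> m\<close> and \<open>1 \<le> r \<le> d\<close> matter.\<close>

definition d_partition :: "nat \<Rightarrow> nat \<Rightarrow> (nat \<Rightarrow> nat set) \<Rightarrow> bool" where
  "d_partition n d P \<longleftrightarrow> (\<forall>r\<in>{1..d}. P r \<subseteq> {1..n}) \<and> disjoint_family_on P {1..d}"

definition skew_bollobas :: "nat \<Rightarrow> nat \<Rightarrow> nat \<Rightarrow> (nat \<Rightarrow> nat \<Rightarrow> nat set) \<Rightarrow> bool" where
  "skew_bollobas n d m A \<longleftrightarrow>
     (\<forall>i\<in>{1..m}. d_partition n d (A i)) \<and>
     (\<forall>i j. 1 \<le> i \<and> i < j \<and> j \<le> m \<longrightarrow>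
        (\<exists>p q. 1 \<le> p \<and> p < q \<and> q \<le> d \<and> A i p \<inter> A j q \<noteq> {}))"

text \<open>The truncated subtraction is harmless when \<open>a 1 + \<dots> + a d \<le> N\<close>, the only case of interest.\<close>

definition multinomial :: "nat \<Rightarrow> nat \<Rightarrow> (nat \<Rightarrow> nat) \<Rightarrow> real" where
  "multinomial N d a =
     fact N / ((\<Prod>r=1..d. fact (a r)) * fact (N - (\<Sum>r=1..d. a r)))"

definition family_support :: "nat \<Rightarrow> nat \<Rightarrow> (nat \<Rightarrow> nat \<Rightarrow> nat set) \<Rightarrow> nat set" where
  "family_support d m A = (\<Union>i\<in>{1..m}. \<Union>r\<in>{1..d}. A i r)"

end

theory Submission
  imports Defs
begin

text \<open>
  The bound is a Polya urn in disguise. Colour the points of a set one after another with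
  \<open>d\<close> colours, where a point of the block \<open>X k\<close> receives colour \<open>r\<close> with probability
  \<open>(a\<^sub>r + 1) / (N + d)\<close> if \<open>a\<^sub>r\<close> of the \<open>N\<close> points of \<open>X k\<close> coloured so far have colour \<open>r\<close>.
  The probability of a colouring depends only on the numbers of points of each colour in each
  block: it is a product over the blocks of

    \<open>(d - 1)! * a\<^sub>1! * \<dots> * a\<^sub>d! / (N + d - 1)!\<close>,

  which is the reciprocal of the multinomial coefficient, divided by
  \<open>(N + d - 1) choose (d - 1)\<close> (\<open>inverse_multinomial_eq_polya\<close>).

  A \<open>d\<close>-partition is a partial colouring, and its probability is the sum of the
  probabilities of the total colourings of the support that extend it
  (\<open>sum_urn_completions\<close>). In a skew Bollobas system two different members give different
  colours to some common point, so no total colouring extends both. Hence the probabilities of the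
  members add up to at most \<open>1\<close>. A member has at most \<open>s\<^sub>k\<close> points in \<open>X k\<close>, so replacing its
  binomial factors by \<open>(s\<^sub>k + d - 1) choose (d - 1)\<close> can only increase the sum, and this is the
  upper bound.

  Equality needs members that are total colourings and exhaust all of them. The set of all
  colourings of \<open>{1..n}\<close> qualifies: if it is listed by increasing sum of colours, an earlier
  colouring cannot dominate a later one pointwise, so it has a smaller colour somewhere.
\<close>

section \<open>The weight of a colour count\<close>

text \<open>
  The probability that Polya's urn, started with one ball of each of the colours \<open>1, \<dots>, d\<close>,
  yields a prescribed sequence of draws in which colour \<open>r\<close> occurs \<open>a r\<close> times; the order of the
  draws does not affect it.
\<close>

definition polya :: "nat \<Rightarrow> (nat \<Rightarrow> nat) \<Rightarrow> real" where
  "polya d a = fact (d - 1) * (\<Prod>r=1..d. fact (a r)) / fact ((\<Sum>r=1..d. a r) + d - 1)"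

lemma polya_nonneg: "polya d a \<ge> 0"
  unfolding polya_def by (intro divide_nonneg_nonneg mult_nonneg_nonneg prod_nonneg) auto

lemma polya_zero: "polya d (\<lambda>_. 0) = 1"
  by (simp add: polya_def)

lemma polya_cong:
  assumes "\<And>r. r \<in> {1..d} \<Longrightarrow> a r = b r"
  shows "polya d a = polya d b"
proof -
  have "(\<Sum>r=1..d. a r) = (\<Sum>r=1..d. b r)"
    "(\<Prod>r=1..d. fact (a r) :: real) = (\<Prod>r=1..d. fact (b r))"
    using assms by (auto intro: sum.cong prod.cong)
  then show ?thesis
    by (simp only: polya_def)
qed

lemma polya_Suc:
  assumes "r \<in> {1..d}"
  shows "polya d (a(r := Suc (a r))) = polya d a * (a r + 1) / ((\<Sum>s=1..d. a s) + d)"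
proof -
  have "(\<Sum>s\<in>{1..d}. (a(r := Suc (a r))) s)
      = Suc (a r) + (\<Sum>s\<in>{1..d} - {r}. (a(r := Suc (a r))) s)"
    using assms by (subst sum.remove[of _ r]) auto
  also have "(\<Sum>s\<in>{1..d} - {r}. (a(r := Suc (a r))) s) = (\<Sum>s\<in>{1..d} - {r}. a s)"
    by (intro sum.cong) auto
  also have "Suc (a r) + \<dots> = Suc (\<Sum>s\<in>{1..d}. a s)"
    using assms by (subst (2) sum.remove[of _ r]) auto
  finally have S: "(\<Sum>s=1..d. (a(r := Suc (a r))) s) = Suc (\<Sum>s=1..d. a s)" .
  have "(\<Prod>s\<in>{1..d}. fact ((a(r := Suc (a r))) s) :: real)
      = fact (Suc (a r)) * (\<Prod>s\<in>{1..d} - {r}. fact ((a(r := Suc (a r))) s))"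
    using assms by (subst prod.remove[of _ r]) auto
  also have "(\<Prod>s\<in>{1..d} - {r}. fact ((a(r := Suc (a r))) s) :: real)
      = (\<Prod>s\<in>{1..d} - {r}. fact (a s))"
    by (intro prod.cong) auto
  also have "fact (Suc (a r)) * \<dots> = real (a r + 1) * (\<Prod>s\<in>{1..d}. fact (a s) :: real)"
    using assms by (subst (2) prod.remove[of _ r]) auto
  finally have P: "(\<Prod>s=1..d. fact ((a(r := Suc (a r))) s) :: real)
      = real (a r + 1) * (\<Prod>s=1..d. fact (a s))" .
  define N where "N = (\<Sum>s=1..d. a s)"
  have "N + d > 0"
    using assms by auto
  then have F: "(fact (Suc N + d - 1) :: real) = real (N + d) * fact (N + d - 1)"
    by (simp add: fact_reduce)
  show ?thesis
    unfolding polya_def S P N_def[symmetric] F by (simp add: mult_ac)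
qed

text \<open>The transition probabilities of the urn add up to \<open>1\<close>.\<close>

lemma sum_polya_Suc:
  assumes "d \<ge> 1"
  shows "(\<Sum>r=1..d. polya d (a(r := Suc (a r)))) = polya d a"
proof -
  define N where "N = (\<Sum>r=1..d. a r)"
  have "(\<Sum>r=1..d. polya d (a(r := Suc (a r)))) = (\<Sum>r=1..d. polya d a * ((a r + 1) / (N + d)))"
    by (intro sum.cong) (auto simp: polya_Suc N_def)
  also have "\<dots> = polya d a * ((\<Sum>r=1..d. real (a r) + 1) / (N + d))"
    by (simp add: sum_distrib_left sum_divide_distrib add.commute)
  also have "(\<Sum>r=1..d. real (a r) + 1) = N + d"
    by (simp add: N_def sum.distrib)
  also have "polya d a * (real (N + d) / real (N + d)) = polya d a"
    using assms by simp
  finally show ?thesis .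
qed

lemma inverse_multinomial_eq_polya:
  assumes "d \<ge> 1"
  shows "inverse (multinomial (\<Sum>r=1..d. a r) d a)
    = real (((\<Sum>r=1..d. a r) + d - 1) choose (d - 1)) * polya d a"
  using assms
  by (simp add: multinomial_def polya_def binomial_fact field_simps)

section \<open>Weights of partial colourings\<close>

text \<open>
  The probability that the urn processes of the blocks, which run independently of each other,
  produce the partial colouring with colour classes \<open>P 1, \<dots>, P d\<close>.
\<close>

definition urn :: "'k set \<Rightarrow> ('k \<Rightarrow> 'a set) \<Rightarrow> nat \<Rightarrow> (nat \<Rightarrow> 'a set) \<Rightarrow> real" where
  "urn K X d P = (\<Prod>k\<in>K. polya d (\<lambda>r. card (P r \<inter> X k)))"

lemma urn_nonneg: "urn K X d P \<ge> 0"
  by (auto simp: urn_def intro!: prod_nonneg polya_nonneg)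

lemma urn_cong: "(\<And>r. r \<in> {1..d} \<Longrightarrow> P r = Q r) \<Longrightarrow> urn K X d P = urn K X d Q"
  unfolding urn_def by (intro prod.cong refl polya_cong) auto

text \<open>Colouring a point changes the counts of its own block only, so this is one urn step.\<close>

lemma sum_urn_insert:
  assumes "finite K" "disjoint_family_on X K" "x \<in> (\<Union>k\<in>K. X k)" "d \<ge> 1"
    and fin: "\<And>r. r \<in> {1..d} \<Longrightarrow> finite (P r)" and new: "\<And>r. r \<in> {1..d} \<Longrightarrow> x \<notin> P r"
  shows "(\<Sum>r=1..d. urn K X d (P(r := insert x (P r)))) = urn K X d P"
proof -
  obtain l where l: "l \<in> K" "x \<in> X l"
    using assms by auto
  have other: "x \<notin> X k" if "k \<in> K - {l}" for k
    using assms(2) l that unfolding disjoint_family_on_def by blast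
  define c where "c k r = card (P r \<inter> X k)" for k r
  have "urn K X d (P(r := insert x (P r)))
      = polya d ((c l)(r := Suc (c l r))) * (\<Prod>k\<in>K - {l}. polya d (c k))" if r: "r \<in> {1..d}" for r
  proof -
    have "(\<lambda>s. card ((P(r := insert x (P r))) s \<inter> X l)) = (c l)(r := Suc (c l r))"
      using l fin[OF r] new[OF r] by (auto simp: c_def)
    moreover have "(\<lambda>s. card ((P(r := insert x (P r))) s \<inter> X k)) = c k" if "k \<in> K - {l}" for k
      using other[OF that] by (auto simp: c_def)
    ultimately show ?thesis
      unfolding urn_def prod.remove[OF assms(1) l(1)] by (simp only: cong: prod.cong)
  qed
  then have "(\<Sum>r=1..d. urn K X d (P(r := insert x (P r))))
      = (\<Sum>r=1..d. polya d ((c l)(r := Suc (c l r)))) * (\<Prod>k\<in>K - {l}. polya d (c k))"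
    by (simp add: sum_distrib_right)
  also have "\<dots> = polya d (c l) * (\<Prod>k\<in>K - {l}. polya d (c k))"
    using sum_polya_Suc[OF assms(4), of "c l"] by simp
  also have "\<dots> = urn K X d P"
    unfolding urn_def c_def[symmetric] using assms(1) l(1) by (simp add: prod.remove[of _ l])
  finally show ?thesis .
qed

definition color_classes :: "'a set \<Rightarrow> ('a \<Rightarrow> nat) \<Rightarrow> nat \<Rightarrow> 'a set" where
  "color_classes S f r = {x \<in> S. f x = r}"

definition completions :: "nat \<Rightarrow> 'a set \<Rightarrow> (nat \<Rightarrow> 'a set) \<Rightarrow> ('a \<Rightarrow> nat) set" where
  "completions d S P = {f \<in> S \<rightarrow>\<^sub>E {1..d}. \<forall>r\<in>{1..d}. \<forall>x\<in>P r. f x = r}"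

lemma finite_completions: "finite S \<Longrightarrow> finite (completions d S P)"
  unfolding completions_def by (rule finite_subset[of _ "S \<rightarrow>\<^sub>E {1..d}"]) (auto intro: finite_PiE)

lemma completions_insert:
  assumes "x \<in> S"
  shows "completions d S P = (\<Union>r\<in>{1..d}. completions d S (P(r := insert x (P r))))"
proof (intro equalityI subsetI)
  fix f assume f: "f \<in> completions d S P"
  then have "f x \<in> {1..d}"
    using assms by (auto simp: completions_def PiE_iff)
  moreover have "f \<in> completions d S (P(f x := insert x (P (f x))))"
    using f by (auto simp: completions_def)
  ultimately show "f \<in> (\<Union>r\<in>{1..d}. completions d S (P(r := insert x (P r))))"
    by blast
next
  fix f assume "f \<in> (\<Union>r\<in>{1..d}. completions d S (P(r := insert x (P r))))"
  then obtain r where "r \<in> {1..d}" "f \<in> completions d S (P(r := insert x (P r)))"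
    by blast
  then show "f \<in> completions d S P"
    unfolding completions_def by (auto split: if_splits)
qed

lemma disjoint_completions:
  assumes "p \<in> {1..d}" "q \<in> {1..d}" "p \<noteq> q" "P p \<inter> Q q \<noteq> {}"
  shows "completions d S P \<inter> completions d S Q = {}"
proof -
  obtain x where "x \<in> P p" "x \<in> Q q"
    using assms(4) by blast
  then have "f x = p" if "f \<in> completions d S P" for f
    using that assms(1) unfolding completions_def by blast
  moreover have "f x = q" if "f \<in> completions d S Q" for f
    using that assms(2) \<open>x \<in> Q q\<close> unfolding completions_def by blast
  ultimately show ?thesis
    using assms(3) by blast
qed

lemma completions_total:
  assumes "disjoint_family_on P {1..d}" "S = (\<Union>r\<in>{1..d}. P r)"
  shows "\<exists>f. completions d S P = {f} \<and> (\<forall>r\<in>{1..d}. color_classes S f r = P r)"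
proof -
  have "\<forall>x\<in>S. \<exists>r\<in>{1..d}. x \<in> P r"
    using assms(2) by blast
  then obtain g where g: "\<And>x. x \<in> S \<Longrightarrow> g x \<in> {1..d} \<and> x \<in> P (g x)"
    by metis
  have col: "x \<in> P r \<longleftrightarrow> x \<in> S \<and> g x = r" if "r \<in> {1..d}" for x r
    using assms that g[of x] unfolding disjoint_family_on_def by blast
  have "f = restrict g S" if f: "f \<in> completions d S P" for f
  proof
    fix x
    show "f x = restrict g S x"
      using f g[of x] by (cases "x \<in> S") (auto simp: completions_def PiE_iff extensional_def)
  qed
  moreover have "restrict g S \<in> completions d S P"
    using g col by (auto simp: completions_def)
  ultimately have "completions d S P = {restrict g S}"
    by blast
  moreover have "\<forall>r\<in>{1..d}. color_classes S (restrict g S) r = P r"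
    using col by (auto simp: color_classes_def)
  ultimately show ?thesis
    by blast
qed

text \<open>
  The urn may treat the points in any order, so it may begin with those coloured by \<open>P\<close>. Each
  remaining point splits the completions according to its colour and preserves the total weight.
\<close>

lemma sum_urn_completions:
  assumes "finite K" "disjoint_family_on X K" "finite S" "S \<subseteq> (\<Union>k\<in>K. X k)" "d \<ge> 1"
    and "disjoint_family_on P {1..d}" "(\<Union>r\<in>{1..d}. P r) \<subseteq> S"
  shows "(\<Sum>f\<in>completions d S P. urn K X d (color_classes S f)) = urn K X d P"
proof -
  have "finite (S - (\<Union>r\<in>{1..d}. P r))"
    using assms(3) by simp
  then show ?thesis
    using assms(6,7)
  proof (induction "S - (\<Union>r\<in>{1..d}. P r)" arbitrary: P rule: finite_induct)
    case empty
    then have "S = (\<Union>r\<in>{1..d}. P r)"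
      by blast
    then obtain f where f: "completions d S P = {f}" "\<forall>r\<in>{1..d}. color_classes S f r = P r"
      using completions_total[OF empty.prems(1)] by blast
    then have "urn K X d (color_classes S f) = urn K X d P"
      by (intro urn_cong) blast
    with f(1) show ?case
      by simp
  next
    case (insert x F)
    have x: "x \<in> S" "\<And>r. r \<in> {1..d} \<Longrightarrow> x \<notin> P r"
      using insert.hyps by blast+
    let ?P = "\<lambda>r. P(r := insert x (P r))"
    have IH: "(\<Sum>f\<in>completions d S (?P r). urn K X d (color_classes S f)) = urn K X d (?P r)"
      if r: "r \<in> {1..d}" for r
    proof (rule insert.hyps(3))
      have U: "(\<Union>s\<in>{1..d}. ?P r s) = insert x (\<Union>s\<in>{1..d}. P s)"
        using r by (auto split: if_splits)
      show "F = S - (\<Union>s\<in>{1..d}. ?P r s)"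
        using insert.hyps(2,4) unfolding U by blast
      show "(\<Union>s\<in>{1..d}. ?P r s) \<subseteq> S"
        using insert.prems x unfolding U by blast
      show "disjoint_family_on (?P r) {1..d}"
        using insert.prems(1) x(2) unfolding disjoint_family_on_def by auto
    qed
    have disj: "completions d S (?P r) \<inter> completions d S (?P s) = {}"
      if "r \<in> {1..d}" "s \<in> {1..d}" "r \<noteq> s" for r s
      using that by (intro disjoint_completions[of r d s]) auto
    have "(\<Sum>f\<in>completions d S P. urn K X d (color_classes S f))
        = (\<Sum>r=1..d. \<Sum>f\<in>completions d S (?P r). urn K X d (color_classes S f))"
      using disj assms(3)
      by (subst completions_insert[OF x(1)], intro sum.UNION_disjoint)
        (auto intro: finite_completions)
    also have "\<dots> = (\<Sum>r=1..d. urn K X d (?P r))"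
      using IH by simp
    also have "\<dots> = urn K X d P"
    proof (intro sum_urn_insert)
      show "finite (P r)" if "r \<in> {1..d}" for r
        using insert.prems(2) assms(3) that by (meson UN_subset_iff finite_subset)
    qed (use assms x in auto)
    finally show ?case .
  qed
qed

lemma sum_urn_colorings:
  assumes "finite K" "disjoint_family_on X K" "finite S" "S \<subseteq> (\<Union>k\<in>K. X k)" "d \<ge> 1"
  shows "(\<Sum>f\<in>S \<rightarrow>\<^sub>E {1..d}. urn K X d (color_classes S f)) = 1"
proof -
  have "completions d S (\<lambda>_. {}) = S \<rightarrow>\<^sub>E {1..d}"
    by (auto simp: completions_def)
  moreover have "urn K X d (\<lambda>_. {}) = 1"
    by (simp add: urn_def polya_zero)
  ultimately show ?thesis
    using sum_urn_completions[OF assms, of "\<lambda>_. {}"] by (simp add: disjoint_family_on_def)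
qed

lemma inverse_prod_multinomial_eq_urn:
  assumes "d \<ge> 1"
  shows "inverse (\<Prod>k\<in>K. multinomial (\<Sum>r=1..d. card (P r \<inter> X k)) d (\<lambda>r. card (P r \<inter> X k)))
    = (\<Prod>k\<in>K. real (((\<Sum>r=1..d. card (P r \<inter> X k)) + d - 1) choose (d - 1))) * urn K X d P"
proof -
  have "inverse (\<Prod>k\<in>K. multinomial (\<Sum>r=1..d. card (P r \<inter> X k)) d (\<lambda>r. card (P r \<inter> X k)))
    = (\<Prod>k\<in>K. inverse (multinomial (\<Sum>r=1..d. card (P r \<inter> X k)) d (\<lambda>r. card (P r \<inter> X k))))"
    by (rule prod_inversef[symmetric, unfolded comp_def])
  also have "\<dots> = (\<Prod>k\<in>K. real (((\<Sum>r=1..d. card (P r \<inter> X k)) + d - 1) choose (d - 1))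
      * polya d (\<lambda>r. card (P r \<inter> X k)))"
    by (intro prod.cong refl inverse_multinomial_eq_polya[OF assms])
  also have "\<dots> = (\<Prod>k\<in>K. real (((\<Sum>r=1..d. card (P r \<inter> X k)) + d - 1) choose (d - 1)))
      * urn K X d P"
    unfolding urn_def by (rule prod.distrib)
  finally show ?thesis .
qed

section \<open>Skew Bollobas systems\<close>

lemma sum_card_disjoint_Int:
  fixes P :: "nat \<Rightarrow> 'a set"
  assumes "disjoint_family_on P {1..d}" "\<And>r. r \<in> {1..d} \<Longrightarrow> finite (P r)"
  shows "(\<Sum>r=1..d. card (P r \<inter> Y)) = card ((\<Union>r\<in>{1..d}. P r) \<inter> Y)"
proof -
  have "card (\<Union>r\<in>{1..d}. P r \<inter> Y) = (\<Sum>r=1..d. card (P r \<inter> Y))"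
    using assms by (intro card_UN_disjoint) (auto dest: disjoint_family_onD)
  moreover have "(\<Union>r\<in>{1..d}. P r \<inter> Y) = (\<Union>r\<in>{1..d}. P r) \<inter> Y"
    by blast
  ultimately show ?thesis
    by simp
qed

text \<open>
  Two members give different colours to some common point, so their sets of completions are
  disjoint events.
\<close>

lemma skew_bollobas_sum_urn_le_1:
  assumes "skew_bollobas n d m A" "d \<ge> 1" "finite K" "disjoint_family_on X K" "finite S"
    and "S \<subseteq> (\<Union>k\<in>K. X k)" "family_support d m A \<subseteq> S"
  shows "(\<Sum>i=1..m. urn K X d (A i)) \<le> 1"
proof -
  have disj: "completions d S (A i) \<inter> completions d S (A j) = {}"
    if "i \<in> {1..m}" "j \<in> {1..m}" "i < j" for i j
  proof -
    have "1 \<le> i" "j \<le> m"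
      using that by auto
    then obtain p q where "1 \<le> p" "p < q" "q \<le> d" "A i p \<inter> A j q \<noteq> {}"
      using assms(1) \<open>i < j\<close> unfolding skew_bollobas_def by metis
    then show ?thesis
      by (intro disjoint_completions[of p d q]) auto
  qed
  have disj': "\<forall>i\<in>{1..m}. \<forall>j\<in>{1..m}. i \<noteq> j \<longrightarrow> completions d S (A i) \<inter> completions d S (A j) = {}"
    using disj by (metis Int_commute nat_neq_iff)
  have "(\<Sum>i=1..m. urn K X d (A i))
      = (\<Sum>i=1..m. \<Sum>f\<in>completions d S (A i). urn K X d (color_classes S f))"
  proof (intro sum.cong refl sum_urn_completions[symmetric] assms)
    fix i assume i: "i \<in> {1..m}"
    then show "disjoint_family_on (A i) {1..d}"
      using assms(1) by (auto simp: skew_bollobas_def d_partition_def)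
    show "(\<Union>r\<in>{1..d}. A i r) \<subseteq> S"
      using i assms(7) unfolding family_support_def by blast
  qed
  also have "\<dots> = (\<Sum>f\<in>(\<Union>i\<in>{1..m}. completions d S (A i)). urn K X d (color_classes S f))"
    using disj' assms(5) by (intro sum.UNION_disjoint[symmetric]) (auto intro: finite_completions)
  also have "\<dots> \<le> (\<Sum>f\<in>S \<rightarrow>\<^sub>E {1..d}. urn K X d (color_classes S f))"
    using assms(5) by (intro sum_mono2) (auto simp: completions_def urn_nonneg intro!: finite_PiE)
  also have "\<dots> = 1"
    by (intro sum_urn_colorings assms)
  finally show ?thesis .
qed

theorem skew_bollobas_weighted_bound:
  assumes A: "skew_bollobas n d m A" and d: "d \<ge> 1"
    and X: "finite K" "disjoint_family_on X K" "{1..n} \<subseteq> (\<Union>k\<in>K. X k)"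
  shows "(\<Sum>i=1..m. inverse (\<Prod>k\<in>K.
      multinomial (\<Sum>r=1..d. card (A i r \<inter> X k)) d (\<lambda>r. card (A i r \<inter> X k))))
    \<le> (\<Prod>k\<in>K. real ((card (family_support d m A \<inter> X k) + d - 1) choose (d - 1)))"
    (is "_ \<le> ?B")
proof -
  let ?S = "family_support d m A"
  have S: "?S \<subseteq> {1..n}"
    using A unfolding family_support_def skew_bollobas_def d_partition_def by blast
  then have fS: "finite ?S"
    by (rule finite_subset) simp
  have "(\<Prod>k\<in>K. real (((\<Sum>r=1..d. card (A i r \<inter> X k)) + d - 1) choose (d - 1))) \<le> ?B"
    if i: "i \<in> {1..m}" for i
  proof (intro prod_mono conjI)
    fix k assume "k \<in> K"
    have sub: "(\<Union>r\<in>{1..d}. A i r) \<subseteq> ?S"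
      using i unfolding family_support_def by blast
    then have "finite (A i r)" if "r \<in> {1..d}" for r
      using fS that by (meson UN_subset_iff finite_subset)
    then have "(\<Sum>r=1..d. card (A i r \<inter> X k)) = card ((\<Union>r\<in>{1..d}. A i r) \<inter> X k)"
      using A i by (intro sum_card_disjoint_Int) (auto simp: skew_bollobas_def d_partition_def)
    also have "\<dots> \<le> card (?S \<inter> X k)"
      using fS sub by (intro card_mono) auto
    finally show "real (((\<Sum>r=1..d. card (A i r \<inter> X k)) + d - 1) choose (d - 1))
        \<le> real ((card (?S \<inter> X k) + d - 1) choose (d - 1))"
      by (intro of_nat_mono binomial_right_mono) simp
  qed simp
  then have "(\<Sum>i=1..m. inverse (\<Prod>k\<in>K.
      multinomial (\<Sum>r=1..d. card (A i r \<inter> X k)) d (\<lambda>r. card (A i r \<inter> X k))))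
    \<le> (\<Sum>i=1..m. ?B * urn K X d (A i))"
    unfolding inverse_prod_multinomial_eq_urn[OF d]
    by (intro sum_mono mult_right_mono urn_nonneg) auto
  also have "\<dots> = ?B * (\<Sum>i=1..m. urn K X d (A i))"
    by (simp add: sum_distrib_left)
  also have "\<dots> \<le> ?B * 1"
    using A d X S fS
    by (intro mult_left_mono skew_bollobas_sum_urn_le_1[where n = n and S = "?S"])
      (auto intro!: prod_nonneg)
  finally show ?thesis
    by simp
qed

section \<open>The system of all colourings\<close>

lemma ex_enumeration_mono_key:
  fixes key :: "'a \<Rightarrow> 'b::linorder"
  assumes "finite F"
  shows "\<exists>h. bij_betw h {1..card F} F
    \<and> (\<forall>i j. 1 \<le> i \<and> i < j \<and> j \<le> card F \<longrightarrow> key (h i) \<le> key (h j))"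
proof -
  obtain ys where ys: "set ys = F" "distinct ys"
    using finite_distinct_list[OF assms] by blast
  define xs where "xs = sort_key key ys"
  have xs: "set xs = F" "distinct xs" "sorted (map key xs)"
    using ys by (auto simp: xs_def)
  have len: "length xs = card F"
    using distinct_card[OF xs(2)] xs(1) by simp
  have "bij_betw ((!) xs) {..<card F} F"
    using bij_betw_nth[OF xs(2)] xs(1) len by simp
  moreover have "bij_betw (\<lambda>i. i - 1) {1..card F} {..<card F}"
    by (rule bij_betw_byWitness[where f' = Suc]) auto
  ultimately have "bij_betw (\<lambda>i. xs ! (i - 1)) {1..card F} F"
    using bij_betw_trans unfolding comp_def by blast
  moreover have "key (xs ! (i - 1)) \<le> key (xs ! (j - 1))"
    if "1 \<le> i" "i < j" "j \<le> card F" for i j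
    using sorted_nth_mono[OF xs(3), of "i - 1" "j - 1"] that len by simp
  ultimately show ?thesis
    by blast
qed

text \<open>
  For total colourings nothing is lost: a member has all the points of each block, and the
  completions of the members exhaust the colourings. The order by sum of colours turns the mere
  difference of two colourings into the required strict inequality at some point.
\<close>

theorem skew_bollobas_all_colorings:
  assumes d: "d \<ge> 1"
    and X: "finite K" "disjoint_family_on X K" "{1..n} \<subseteq> (\<Union>k\<in>K. X k)"
  shows "\<exists>m A. skew_bollobas n d m A \<and> family_support d m A = {1..n} \<and>
    (\<Sum>i=1..m. inverse (\<Prod>k\<in>K.
      multinomial (\<Sum>r=1..d. card (A i r \<inter> X k)) d (\<lambda>r. card (A i r \<inter> X k))))
    = (\<Prod>k\<in>K. real ((card ({1..n} \<inter> X k) + d - 1) choose (d - 1)))"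
proof -
  let ?S = "{1..n}"
  define F where "F = ?S \<rightarrow>\<^sub>E {1..d}"
  define m where "m = card F"
  have fF: "finite F"
    unfolding F_def by (intro finite_PiE) auto
  have "(\<lambda>x\<in>?S. 1) \<in> F"
    using d by (auto simp: F_def)
  then have m: "m \<ge> 1"
    using fF unfolding m_def by (metis One_nat_def Suc_leI card_gt_0_iff empty_iff)
  obtain h where h: "bij_betw h {1..m} F"
    and mono: "\<And>i j. 1 \<le> i \<Longrightarrow> i < j \<Longrightarrow> j \<le> m \<Longrightarrow> (\<Sum>x\<in>?S. h i x) \<le> (\<Sum>x\<in>?S. h j x)"
    using ex_enumeration_mono_key[OF fF, of "\<lambda>f. \<Sum>x\<in>?S. f x"] unfolding m_def by blast
  have hF: "h i \<in> F" if "i \<in> {1..m}" for i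
    using h that by (auto simp: bij_betw_def)
  define A where "A i = color_classes ?S (h i)" for i
  have union: "(\<Union>r\<in>{1..d}. A i r) = ?S" if "i \<in> {1..m}" for i
    using hF[OF that] by (auto simp: A_def color_classes_def F_def PiE_iff)
  have dp: "d_partition n d (A i)" for i
    by (auto simp: d_partition_def A_def color_classes_def disjoint_family_on_def)
  have "\<exists>p q. 1 \<le> p \<and> p < q \<and> q \<le> d \<and> A i p \<inter> A j q \<noteq> {}" if ij: "1 \<le> i" "i < j" "j \<le> m" for i j
  proof -
    have F: "h i \<in> F" "h j \<in> F"
      using ij hF by auto
    have "h i \<noteq> h j"
      using inj_on_eq_iff[OF bij_betw_imp_inj_on[OF h], of i j] ij by auto
    then have "\<exists>x\<in>?S. h i x \<noteq> h j x"
      using PiE_ext[OF F[unfolded F_def]] by blast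
    have "\<exists>x\<in>?S. h i x < h j x"
    proof (rule ccontr)
      assume "\<not> (\<exists>x\<in>?S. h i x < h j x)"
      then have le: "\<forall>x\<in>?S. h j x \<le> h i x"
        by (simp add: not_less)
      with \<open>\<exists>x\<in>?S. h i x \<noteq> h j x\<close> have "\<exists>x\<in>?S. h j x < h i x"
        by (metis nat_less_le)
      with le have "(\<Sum>x\<in>?S. h j x) < (\<Sum>x\<in>?S. h i x)"
        by (intro sum_strict_mono_ex1) auto
      with mono[OF ij] show False
        by simp
    qed
    then obtain x where x: "x \<in> ?S" "h i x < h j x"
      by blast
    then have "x \<in> A i (h i x) \<inter> A j (h j x)" "1 \<le> h i x" "h j x \<le> d"
      using F unfolding F_def A_def color_classes_def by (auto simp: PiE_iff)
    with x(2) show ?thesis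
      by blast
  qed
  with dp have "skew_bollobas n d m A"
    by (auto simp: skew_bollobas_def)
  moreover have "family_support d m A = ?S"
    using union m unfolding family_support_def by auto
  moreover have "(\<Sum>i=1..m. inverse (\<Prod>k\<in>K.
      multinomial (\<Sum>r=1..d. card (A i r \<inter> X k)) d (\<lambda>r. card (A i r \<inter> X k))))
    = (\<Prod>k\<in>K. real ((card (?S \<inter> X k) + d - 1) choose (d - 1)))" (is "_ = ?B")
  proof -
    have "(\<Sum>r=1..d. card (A i r \<inter> X k)) = card (?S \<inter> X k)" if "i \<in> {1..m}" for i k
      using dp[of i] union[OF that]
      by (subst sum_card_disjoint_Int) (auto simp: d_partition_def A_def color_classes_def)
    then have "(\<Sum>i=1..m. inverse (\<Prod>k\<in>K.
        multinomial (\<Sum>r=1..d. card (A i r \<inter> X k)) d (\<lambda>r. card (A i r \<inter> X k))))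
      = (\<Sum>i=1..m. ?B * urn K X d (A i))"
      unfolding inverse_prod_multinomial_eq_urn[OF d] by simp
    also have "\<dots> = ?B * (\<Sum>i=1..m. urn K X d (color_classes ?S (h i)))"
      by (simp add: A_def sum_distrib_left)
    also have "(\<Sum>i=1..m. urn K X d (color_classes ?S (h i)))
        = (\<Sum>f\<in>F. urn K X d (color_classes ?S f))"
      using h by (rule sum.reindex_bij_betw)
    also have "\<dots> = 1"
      unfolding F_def using X d by (intro sum_urn_colorings) auto
    finally show ?thesis
      by simp
  qed
  ultimately show ?thesis
    by blast
qed

theorem theorem1p7:
  fixes d e n :: nat and X :: "nat \<Rightarrow> nat set"
  assumes "d \<ge> 2" and "e \<ge> 1" and "n \<ge> 1"
    and "disjoint_family_on X {1..e}"
    and "(\<Union>k\<in>{1..e}. X k) = {1..n}"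
  shows "(\<forall>m A. skew_bollobas n d m A \<longrightarrow>
            (\<Sum>i=1..m. inverse (\<Prod>k=1..e.
               multinomial (\<Sum>r=1..d. card (A i r \<inter> X k)) d (\<lambda>r. card (A i r \<inter> X k))))
            \<le> (\<Prod>k=1..e. real ((card (family_support d m A \<inter> X k) + d - 1) choose (d - 1))))
       \<and> (\<exists>m A. skew_bollobas n d m A \<and>
            (\<forall>k\<in>{1..e}. card (family_support d m A \<inter> X k) = card (X k)) \<and>
            (\<Sum>i=1..m. inverse (\<Prod>k=1..e.
               multinomial (\<Sum>r=1..d. card (A i r \<inter> X k)) d (\<lambda>r. card (A i r \<inter> X k))))
            = (\<Prod>k=1..e. real ((card (family_support d m A \<inter> X k) + d - 1) choose (d - 1))))"
proof -
  have d: "d \<ge> 1" and cover: "{1..n} \<subseteq> (\<Union>k\<in>{1..e}. X k)"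
    using assms by auto
  obtain m A where A: "skew_bollobas n d m A" and S: "family_support d m A = {1..n}"
    and eq: "(\<Sum>i=1..m. inverse (\<Prod>k=1..e.
        multinomial (\<Sum>r=1..d. card (A i r \<inter> X k)) d (\<lambda>r. card (A i r \<inter> X k))))
      = (\<Prod>k=1..e. real ((card ({1..n} \<inter> X k) + d - 1) choose (d - 1)))"
    using skew_bollobas_all_colorings[OF d finite_atLeastAtMost assms(4) cover] by blast
  have "\<forall>k\<in>{1..e}. card (family_support d m A \<inter> X k) = card (X k)"
  proof
    fix k assume "k \<in> {1..e}"
    then have "{1..n} \<inter> X k = X k"
      using assms(5) by blast
    then show "card (family_support d m A \<inter> X k) = card (X k)"
      by (simp only: S)
  qed
  with A eq[folded S] show ?thesis
    using skew_bollobas_weighted_bound[OF _ d finite_atLeastAtMost assms(4) cover] by blast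
qed

end
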